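(* Let $(X,d)$ be an ultrametric space with $|X|\geq 2$. Then the following statements are equivalent: (i) $(X,d)$ is weakly similar to an unbounded ultrametric space. (ii) The diametrical graph $G_{X,d}$ is empty.
   Context: An ultrametric on $X$ is a metric $d$ with $d(x,y)\leq\max\{d(x,z),d(z,y)\}$ for all $x,y,z\in X$. The distance set of a metric space $(X,d)$ is $D(X)=\{d(x,y):x,y\in X\}$, and $\operatorname{diam} X=\sup D(X)\in[0,\infty]$; the space is unbounded if $\operatorname{diam} X=\infty$. Nonempty ultrametric spaces $(X,d)$ and $(Y,\rho)$ are weakly similar if there are a bijection $\Phi\colon X\to Y$ and a strictly increasing bijection $\psi\colon D(Y)\to D(X)$ such that $d(x,y)=\psi(\rho(\Phi(x),\Phi(y)))$ for all $x,y\in X$. The diametrical graph $G_{X,d}$ is the simple graph with vertex set $X$ in which $\{u,v\}$ is an edge iff $u\neq v$ and $d(u,v)=\operatorname{diam} X$. A graph is empty if it has no edges. *)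

theory Defs
  imports "HOL-Analysis.Analysis"
begin

locale Ultrametric_space = Metric_space +
  assumes ultrametric:
    "\<lbrakk>x \<in> M; y \<in> M; z \<in> M\<rbrakk> \<Longrightarrow> d x y \<le> max (d x z) (d z y)"

definition distance_set :: "'a set \<Rightarrow> ('a \<Rightarrow> 'a \<Rightarrow> real) \<Rightarrow> real set" where
  "distance_set X d = {d x y | x y. x \<in> X \<and> y \<in> X}"

definition diam :: "'a set \<Rightarrow> ('a \<Rightarrow> 'a \<Rightarrow> real) \<Rightarrow> ennreal" where
  "diam X d = Sup (ennreal ` distance_set X d)"

definition unbounded_space :: "'a set \<Rightarrow> ('a \<Rightarrow> 'a \<Rightarrow> real) \<Rightarrow> bool" where
  "unbounded_space X d \<longleftrightarrow> diam X d = \<infinity>"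

definition weakly_similar ::
    "'a set \<Rightarrow> ('a \<Rightarrow> 'a \<Rightarrow> real) \<Rightarrow> 'b set \<Rightarrow> ('b \<Rightarrow> 'b \<Rightarrow> real) \<Rightarrow> bool" where
  "weakly_similar X d Y \<rho> \<longleftrightarrow>
     X \<noteq> {} \<and> Y \<noteq> {} \<and>
     (\<exists>\<Phi> \<psi>. bij_betw \<Phi> X Y \<and>
        bij_betw \<psi> (distance_set Y \<rho>) (distance_set X d) \<and>
        strict_mono_on (distance_set Y \<rho>) \<psi> \<and>
        (\<forall>x\<in>X. \<forall>y\<in>X. d x y = \<psi> (\<rho> (\<Phi> x) (\<Phi> y))))"

text \<open>A simple graph, possibly infinite, is a pair of a vertex set and a set of two-element
  sets of vertices.\<close>

type_synonym 'a simple_graph = "'a set \<times> 'a set set"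

definition edges :: "'a simple_graph \<Rightarrow> 'a set set" where
  "edges G = snd G"

definition empty_graph :: "'a simple_graph \<Rightarrow> bool" where
  "empty_graph G \<longleftrightarrow> edges G = {}"

definition diametrical_graph :: "'a set \<Rightarrow> ('a \<Rightarrow> 'a \<Rightarrow> real) \<Rightarrow> 'a simple_graph" where
  "diametrical_graph X d =
     (X, {{u, v} | u v. u \<in> X \<and> v \<in> X \<and> u \<noteq> v \<and> ennreal (d u v) = diam X d})"

end

theory Submission
  imports Defs
begin

text \<open>The diametrical graph is empty iff the distance set has no greatest element, a property
  that is invariant under order isomorphism of distance sets and holds for unbounded spaces.
  Conversely, if the distance set is bounded with supremum \<open>s\<close> that is not attained, then
  \<open>t \<mapsto> t / (s - t)\<close> maps it increasingly onto an unbounded set, and composing an ultrametric with a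
  strictly increasing function that fixes \<open>0\<close> gives an ultrametric.\<close>

lemma distance_set_iff: "t \<in> distance_set X d \<longleftrightarrow> (\<exists>x\<in>X. \<exists>y\<in>X. t = d x y)"
  by (auto simp: distance_set_def)

lemma ennreal_dist_le_diam:
  assumes "x \<in> X" "y \<in> X"
  shows "ennreal (d x y) \<le> diam X d"
  unfolding diam_def distance_set_def using assms by (intro Sup_upper imageI) blast

text \<open>A number lies strictly below a supremum iff it lies strictly below some member. The
  assumption \<open>0 \<le> B\<close> matters because \<open>ennreal\<close> sends negative reals to
  \<open>0\<close>.\<close>

lemma less_diam_iff:
  assumes "0 \<le> B"
  shows "ennreal B < diam X d \<longleftrightarrow> (\<exists>x\<in>X. \<exists>y\<in>X. B < d x y)"
  unfolding diam_def less_Sup_iff distance_set_def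
  using ennreal_less_iff[OF assms] by blast

lemma unbounded_space_iff:
  "unbounded_space X d \<longleftrightarrow> (\<forall>B\<ge>0. \<exists>x\<in>X. \<exists>y\<in>X. B < d x y)"
proof
  assume L: "unbounded_space X d"
  show "\<forall>B\<ge>0. \<exists>x\<in>X. \<exists>y\<in>X. B < d x y"
  proof (intro allI impI)
    fix B :: real assume "0 \<le> B"
    have "ennreal B < diam X d" using L by (simp add: unbounded_space_def)
    then show "\<exists>x\<in>X. \<exists>y\<in>X. B < d x y"
      using \<open>0 \<le> B\<close> by (simp add: less_diam_iff)
  qed
next
  assume R: "\<forall>B\<ge>0. \<exists>x\<in>X. \<exists>y\<in>X. B < d x y"
  show "unbounded_space X d"
    unfolding unbounded_space_def
  proof (rule ccontr)
    assume "diam X d \<noteq> \<infinity>"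
    then obtain B where B: "0 \<le> B" "diam X d = ennreal B" by (cases "diam X d") auto
    then have "ennreal B < diam X d" using R less_diam_iff[OF B(1), of X d] by blast
    with B show False by simp
  qed
qed

text \<open>No distance exceeds the diameter, so a pair that is not an edge has a distance strictly
  below it, which means that some other distance is larger. This form speaks only of real distances
  and their order.\<close>

lemma empty_diametrical_graph_iff:
  assumes "Metric_space X d" and two: "\<exists>x\<in>X. \<exists>y\<in>X. x \<noteq> y"
  shows "empty_graph (diametrical_graph X d) \<longleftrightarrow>
    (\<forall>u\<in>X. \<forall>v\<in>X. \<exists>x\<in>X. \<exists>y\<in>X. d u v < d x y)"
proof -
  interpret Metric_space X d by fact
  have E: "empty_graph (diametrical_graph X d) \<longleftrightarrow>
      (\<forall>u\<in>X. \<forall>v\<in>X. u \<noteq> v \<longrightarrow> ennreal (d u v) \<noteq> diam X d)"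
    by (auto simp: empty_graph_def edges_def diametrical_graph_def)
  have less: "ennreal (d u v) < diam X d \<longleftrightarrow> (\<exists>x\<in>X. \<exists>y\<in>X. d u v < d x y)" for u v
    by (simp add: less_diam_iff)
  \<comment> \<open>Pairs \<open>u = v\<close> are never edges, so here the right-hand side has to
    come from two distinct points, whose distance is positive.\<close>
  have diag: "\<exists>x\<in>X. \<exists>y\<in>X. d u u < d x y" if "u \<in> X" for u
    using two that mdist_pos_less by fastforce
  have "(u \<noteq> v \<longrightarrow> ennreal (d u v) \<noteq> diam X d) \<longleftrightarrow> (\<exists>x\<in>X. \<exists>y\<in>X. d u v < d x y)"
    if "u \<in> X" "v \<in> X" for u v
  proof (cases "u = v")
    case True
    then show ?thesis using diag[OF that(1)] by simp
  next
    case False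
    then show ?thesis
      using ennreal_dist_le_diam[OF that, of d] less[of u v] by (metis order_less_le)
  qed
  then show ?thesis
    unfolding E by (intro ball_cong refl) blast
qed

text \<open>In \<open>Y\<close> some distance exceeds that of the images of \<open>u\<close> and
  \<open>v\<close>; surjectivity of \<open>\<Phi>\<close> pulls its endpoints back to
  \<open>X\<close>, and \<open>\<psi>\<close> preserves the strict inequality.\<close>

lemma weakly_similar_unbounded_no_greatest:
  assumes ws: "weakly_similar X d Y \<rho>" and Y: "Metric_space Y \<rho>" and ub: "unbounded_space Y \<rho>"
    and "u \<in> X" "v \<in> X"
  shows "\<exists>x\<in>X. \<exists>y\<in>X. d u v < d x y"
proof -
  interpret Metric_space Y \<rho> by fact
  from ws obtain \<Phi> \<psi> where bij: "bij_betw \<Phi> X Y"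
    and mono: "strict_mono_on (distance_set Y \<rho>) \<psi>"
    and eq: "\<And>x y. x \<in> X \<Longrightarrow> y \<in> X \<Longrightarrow> d x y = \<psi> (\<rho> (\<Phi> x) (\<Phi> y))"
    unfolding weakly_similar_def by blast
  from ub obtain y1 y2 where y: "y1 \<in> Y" "y2 \<in> Y" "\<rho> (\<Phi> u) (\<Phi> v) < \<rho> y1 y2"
    unfolding unbounded_space_iff by (meson nonneg)
  from bij y obtain x1 x2 where x: "x1 \<in> X" "x2 \<in> X" "y1 = \<Phi> x1" "y2 = \<Phi> x2"
    unfolding bij_betw_def by blast
  have "\<psi> (\<rho> (\<Phi> u) (\<Phi> v)) < \<psi> (\<rho> (\<Phi> x1) (\<Phi> x2))"
    using mono bij x y assms(4,5)
    by (intro strict_mono_onD[OF mono]) (auto simp: distance_set_iff bij_betw_def)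
  then show ?thesis using eq x assms(4,5) by auto
qed

text \<open>The strong triangle inequality only compares distances, so it survives any
  \<open>f\<close> that preserves their order. The value \<open>0\<close> outside \<open>X\<close>
  is there because \<open>Metric_space\<close> asks for nonnegativity and symmetry on the whole
  type.\<close>

lemma strict_mono_weakly_similar:
  fixes f :: "real \<Rightarrow> real"
  assumes X: "Ultrametric_space X d" and "X \<noteq> {}"
    and mono: "strict_mono_on (distance_set X d) f" and f0: "f 0 = 0"
  defines "\<rho> \<equiv> (\<lambda>x y. if x \<in> X \<and> y \<in> X then f (d x y) else 0)"
  shows "Ultrametric_space X \<rho>" and "weakly_similar X d X \<rho>"
proof -
  interpret Ultrametric_space X d by fact
  let ?D = "distance_set X d"
  have D: "d x y \<in> ?D" if "x \<in> X" "y \<in> X" for x y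
    using that by (auto simp: distance_set_iff)
  have le: "f (d x y) \<le> f (d a b) \<longleftrightarrow> d x y \<le> d a b"
    if "x \<in> X" "y \<in> X" "a \<in> X" "b \<in> X" for x y a b
    using strict_mono_on_less_eq[OF mono] D that by auto
  have inj: "inj_on f ?D" using mono by (rule strict_mono_on_imp_inj_on)
  have pos: "0 \<le> f (d x y)" and zero: "f (d x y) = 0 \<longleftrightarrow> x = y" if "x \<in> X" "y \<in> X" for x y
  proof -
    show "0 \<le> f (d x y)" using le[of x x x y] that f0 by auto
    have "f (d x y) = f (d x x) \<longleftrightarrow> d x y = d x x"
      using inj_on_eq_iff[OF inj] D that by blast
    then show "f (d x y) = 0 \<longleftrightarrow> x = y" using that f0 by simp
  qed
  have ultra: "\<rho> x y \<le> max (\<rho> x z) (\<rho> z y)" if "x \<in> X" "y \<in> X" "z \<in> X" for x y z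
    using ultrametric[of x y z] le that by (auto simp: \<rho>_def le_max_iff_disj)
  have \<rho>_nonneg: "0 \<le> \<rho> x y" for x y using pos by (simp add: \<rho>_def)
  show "Ultrametric_space X \<rho>"
  proof
    fix x y z assume "x \<in> X" "y \<in> X" "z \<in> X"
    then show "\<rho> x z \<le> \<rho> x y + \<rho> y z"
      using ultra[of x z y] \<rho>_nonneg[of x y] \<rho>_nonneg[of y z] by simp
  qed (use \<rho>_nonneg zero ultra in \<open>auto simp: \<rho>_def commute\<close>)
  have image: "distance_set X \<rho> = f ` ?D"
    by (force simp: distance_set_def \<rho>_def)
  \<comment> \<open>Weak similarity asks for a map from the new distances back to the old ones, so
    \<open>\<psi>\<close> is the inverse of \<open>f\<close> on \<open>?D\<close>, with
    \<open>\<Phi>\<close> the identity.\<close>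
  have "strict_mono_on (f ` ?D) (the_inv_into ?D f)"
    by (intro strict_mono_onI) (auto simp: the_inv_into_f_f[OF inj] strict_mono_on_less[OF mono])
  moreover have "bij_betw (the_inv_into ?D f) (f ` ?D) ?D"
    using inj by (intro bij_betw_the_inv_into) (simp add: bij_betw_def)
  moreover have "\<forall>x\<in>X. \<forall>y\<in>X. d x y = the_inv_into ?D f (\<rho> (id x) (id y))"
    using D by (auto simp: \<rho>_def the_inv_into_f_f[OF inj])
  ultimately show "weakly_similar X d X \<rho>"
    unfolding weakly_similar_def image using \<open>X \<noteq> {}\<close> bij_betw_id by blast
qed

text \<open>If \<open>D\<close> is unbounded, the identity serves. Otherwise the lack of a greatest
  element keeps \<open>s - t\<close> positive on \<open>D\<close>, and \<open>t / (s - t)\<close>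
  grows without bound as \<open>t\<close> approaches \<open>s\<close>.\<close>

lemma unbounded_strict_mono_exists:
  fixes D :: "real set"
  assumes "D \<noteq> {}" and nonneg: "\<And>t. t \<in> D \<Longrightarrow> 0 \<le> t"
    and nomax: "\<And>t. t \<in> D \<Longrightarrow> \<exists>t'\<in>D. t < t'"
  shows "\<exists>f::real \<Rightarrow> real. strict_mono_on D f \<and> f 0 = 0 \<and> (\<forall>B\<ge>0. \<exists>t\<in>D. B < f t)"
proof (cases "bdd_above D")
  case False
  then have "\<forall>B\<ge>0. \<exists>t\<in>D. B < id t" by (force simp: bdd_above_def not_le)
  moreover have "strict_mono_on D id" by (simp add: strict_mono_on_def)
  ultimately show ?thesis by (metis id_apply)
next
  case True
  define s where "s = Sup D"
  have lt: "t < s" if "t \<in> D" for t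
    using nomax[OF that] cSup_upper[OF _ True] by (force simp: s_def)
  then have "0 < s" using \<open>D \<noteq> {}\<close> nonneg by force
  have "strict_mono_on D (\<lambda>t. t / (s - t))"
  proof (rule strict_mono_onI)
    fix a b assume "a \<in> D" "b \<in> D" "a < b"
    \<comment> \<open>Clearing the positive denominators leaves
      \<open>s * a < s * b\<close>.\<close>
    then show "a / (s - a) < b / (s - b)"
      using lt[of a] lt[of b] \<open>0 < s\<close> by (simp add: divide_simps algebra_simps)
  qed
  moreover have "\<exists>t\<in>D. B < t / (s - t)" if "0 \<le> B" for B
  proof -
    \<comment> \<open>The left-hand side is the solution \<open>t\<close> of
      \<open>t / (s - t) = B\<close>.\<close>
    have "s * B / (1 + B) < Sup D"
      using that \<open>0 < s\<close> by (simp add: s_def[symmetric] divide_simps algebra_simps)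
    then obtain t where t: "t \<in> D" "s * B / (1 + B) < t"
      using less_cSup_iff[OF \<open>D \<noteq> {}\<close> True] by blast
    then have "B < t / (s - t)"
      using that lt[of t] by (simp add: divide_simps algebra_simps)
    with t show ?thesis by blast
  qed
  ultimately show ?thesis by (intro exI[of _ "\<lambda>t. t / (s - t)"]) simp
qed

text \<open>A formula cannot quantify over types. The equivalence therefore takes \<open>Y\<close>
  over the type of \<open>X\<close>, which is enough for the construction, and the second conjunct
  gives the forward implication for \<open>Y\<close> over any type \<open>'b\<close>.\<close>

theorem theorem3p18:
  fixes X :: "'a set" and d :: "'a \<Rightarrow> 'a \<Rightarrow> real"
  assumes "Ultrametric_space X d"
    and "\<exists>x\<in>X. \<exists>y\<in>X. x \<noteq> y"
  shows "((\<exists>(Y :: 'a set) \<rho>. Ultrametric_space Y \<rho> \<and> unbounded_space Y \<rho> \<and> weakly_similar X d Y \<rho>)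
            \<longleftrightarrow> empty_graph (diametrical_graph X d)) \<and>
         ((\<exists>(Y :: 'b set) \<rho>. Ultrametric_space Y \<rho> \<and> unbounded_space Y \<rho> \<and> weakly_similar X d Y \<rho>)
            \<longrightarrow> empty_graph (diametrical_graph X d))"
proof -
  interpret Ultrametric_space X d by fact
  note empty_iff = empty_diametrical_graph_iff[OF Metric_space_axioms assms(2)]
  have X_ne: "X \<noteq> {}" using assms(2) by blast
  \<comment> \<open>The witness is \<open>X\<close> itself with its distances rescaled by
    \<open>f\<close>.\<close>
  have "\<exists>(Y :: 'a set) \<rho>. Ultrametric_space Y \<rho> \<and> unbounded_space Y \<rho> \<and> weakly_similar X d Y \<rho>"
    if "empty_graph (diametrical_graph X d)"
  proof -
    have "\<exists>f::real \<Rightarrow> real. strict_mono_on (distance_set X d) f \<and> f 0 = 0 \<and>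
        (\<forall>B\<ge>0. \<exists>t\<in>distance_set X d. B < f t)"
    proof (rule unbounded_strict_mono_exists)
      show "distance_set X d \<noteq> {}" using X_ne by (auto simp: distance_set_def)
      show "\<exists>t'\<in>distance_set X d. t < t'" if "t \<in> distance_set X d" for t
        using that \<open>empty_graph _\<close> unfolding empty_iff by (force simp: distance_set_iff)
    qed (auto simp: distance_set_iff)
    then obtain f :: "real \<Rightarrow> real"
      where f: "strict_mono_on (distance_set X d) f" "f 0 = 0"
        and large: "\<And>B. 0 \<le> B \<Longrightarrow> \<exists>t\<in>distance_set X d. B < f t" by blast
    let ?\<rho> = "\<lambda>x y. if x \<in> X \<and> y \<in> X then f (d x y) else 0"
    have "unbounded_space X ?\<rho>"
      unfolding unbounded_space_iff using large by (force simp: distance_set_iff)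
    then show ?thesis
      using strict_mono_weakly_similar[OF assms(1) X_ne f] by blast
  qed
  moreover have "\<forall>u\<in>X. \<forall>v\<in>X. \<exists>x\<in>X. \<exists>y\<in>X. d u v < d x y"
    if "\<exists>(Y :: 'a set) \<rho>. Ultrametric_space Y \<rho> \<and> unbounded_space Y \<rho> \<and> weakly_similar X d Y \<rho>"
    using that by (blast intro: weakly_similar_unbounded_no_greatest Ultrametric_space.axioms(1))
  moreover have "\<forall>u\<in>X. \<forall>v\<in>X. \<exists>x\<in>X. \<exists>y\<in>X. d u v < d x y"
    if "\<exists>(Y :: 'b set) \<rho>. Ultrametric_space Y \<rho> \<and> unbounded_space Y \<rho> \<and> weakly_similar X d Y \<rho>"
    using that by (blast intro: weakly_similar_unbounded_no_greatest Ultrametric_space.axioms(1))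
  ultimately show ?thesis unfolding empty_iff by argo
qed

end
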